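(* Let $T$ be any tree with order $n\geq 3$, leaf number $\ell$ and $s\geq 2$ support vertices such that $D_T\geq 5$. Then $\mathrm{gp}(\mathcal{M}(T))=n+\ell-s$.
   Context: All graphs are simple, connected and finite. A leaf is a vertex of degree one; the leaf number is the number of leaves; a support vertex is a vertex adjacent to a leaf. Let $y_1,\dots,y_s$ be the support vertices of $T$ and let $L_i$ be the set of leaves adjacent to $y_i$. Then $D_T=\min\{d_T(l,l') : l\in L_i,\ l'\in L_j,\ i\neq j\}$, where $d_T$ is the distance in $T$ (defined when $s\geq 2$). A set $S$ of vertices of a graph $H$ is a general position set if no shortest path in $H$ contains three or more vertices of $S$; $\mathrm{gp}(H)$ is the number of vertices in a largest general position set of $H$. The Mycielskian $\mathcal{M}(G)$ of a graph $G$ with vertex set $V$ and edge set $E$ has vertex set $V\cup V'\cup\{u^*\}$, where $V'=\{u' : u\in V\}$ is a disjoint copy of $V$ and $u^*$ is an additional vertex (the root), and edge set $E\cup\{uv' : uv\in E\}\cup\{v'u^* : v'\in V'\}$ (for each edge $uv\in E$ both $uv'$ and $vu'$ are included). *)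

theory Defs
  imports "Graph_Theory.Graph_Theory"
begin

text \<open>
  Finite simple graphs are rendered by the locale \<^locale>\<open>pair_graph\<close>: an undirected edge
  is a pair of opposite arcs. In such a symmetric digraph \<^const>\<open>pre_digraph.cycle\<close> also
  admits the closed walk traversing an edge back and forth, so \<^const>\<open>tree\<close> would exclude
  every graph with an edge. Hence only cycles of length at least three are forbidden here.
\<close>

definition graph_tree :: "'a pair_pre_digraph \<Rightarrow> bool" where
  "graph_tree T \<longleftrightarrow> pair_graph T \<and> connected (with_proj T) \<and>
     \<not> (\<exists>p. pre_digraph.cycle (with_proj T) p \<and> length p \<ge> 3)"

definition graph_dist :: "'a pair_pre_digraph \<Rightarrow> 'a \<Rightarrow> 'a \<Rightarrow> ereal" where
  "graph_dist G u v = wf_digraph.\<mu> (with_proj G) (\<lambda>_. 1) u v"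

definition shortest_path :: "'a pair_pre_digraph \<Rightarrow> 'a \<Rightarrow> ('a \<times> 'a) awalk \<Rightarrow> 'a \<Rightarrow> bool" where
  "shortest_path G u p v \<longleftrightarrow>
     pre_digraph.apath (with_proj G) u p v \<and> ereal (real (length p)) = graph_dist G u v"

definition leaves :: "'a pair_pre_digraph \<Rightarrow> 'a set" where
  "leaves T = {v \<in> pverts T. out_degree (with_proj T) v = 1}"

definition leaves_at :: "'a pair_pre_digraph \<Rightarrow> 'a \<Rightarrow> 'a set" where
  "leaves_at T y = {l \<in> leaves T. (y, l) \<in> parcs T}"

definition support_vertices :: "'a pair_pre_digraph \<Rightarrow> 'a set" where
  "support_vertices T = {y \<in> pverts T. leaves_at T y \<noteq> {}}"

text \<open>Meaningful only if there are at least two support vertices (otherwise \<^const>\<open>Min\<close>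
  is applied to the empty set).\<close>

definition leaf_dist :: "'a pair_pre_digraph \<Rightarrow> ereal" where
  "leaf_dist T = Min {graph_dist T l l' | l l' y y'.
     y \<in> support_vertices T \<and> y' \<in> support_vertices T \<and> y \<noteq> y' \<and>
     l \<in> leaves_at T y \<and> l' \<in> leaves_at T y'}"

definition general_position :: "'a pair_pre_digraph \<Rightarrow> 'a set \<Rightarrow> bool" where
  "general_position H S \<longleftrightarrow> S \<subseteq> pverts H \<and>
     \<not> (\<exists>u p v. shortest_path H u p v \<and> card (S \<inter> set (pawalk_verts u p)) \<ge> 3)"

definition gp :: "'a pair_pre_digraph \<Rightarrow> nat" where
  "gp H = Max (card ` {S. general_position H S})"

datatype 'a myc_vertex = Orig 'a | Copy 'a | Root

definition mycielskian :: "'a pair_pre_digraph \<Rightarrow> 'a myc_vertex pair_pre_digraph" where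
  "mycielskian G = \<lparr>
     pverts = Orig ` pverts G \<union> Copy ` pverts G \<union> {Root},
     parcs = {(Orig u, Orig v) | u v. (u, v) \<in> parcs G}
           \<union> {(Orig u, Copy v) | u v. (u, v) \<in> parcs G}
           \<union> {(Copy v, Orig u) | u v. (u, v) \<in> parcs G}
           \<union> {(Copy v, Root) | v. v \<in> pverts G}
           \<union> {(Root, Copy v) | v. v \<in> pverts G} \<rparr>"

lemma pair_graph_mycielskian:
  assumes "pair_graph G"
  shows "pair_graph (mycielskian G)"
proof -
  interpret pair_graph G by fact
  have sym: "(v, u) \<in> parcs G" if "(u, v) \<in> parcs G" for u v
    using that pair_sym_arcs by (auto simp: symmetric_def dest: symD)
  have wf: "parcs (mycielskian G) \<subseteq> pverts (mycielskian G) \<times> pverts (mycielskian G)"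
    by (auto simp: mycielskian_def dest: in_arcsD1 in_arcsD2)
  have fin: "finite (pverts (mycielskian G))"
    using pair_finite_verts by (simp add: mycielskian_def)
  have "finite (parcs (mycielskian G))"
    using finite_subset[OF wf] fin by blast
  moreover have "sym (parcs (mycielskian G))"
    by (rule symI) (auto simp: mycielskian_def dest: sym)
  moreover have "fst e \<noteq> snd e" if "e \<in> parcs (mycielskian G)" for e
    using that pair_no_loops by (fastforce simp: mycielskian_def)
  ultimately show ?thesis
    using wf fin by unfold_locales (auto simp: symmetric_def)
qed

end

theory Submission
  imports Defs
begin

text \<open>
  In the Mycielskian every distance is at most four: a distance in \<open>T\<close> survives between two
  originals up to the value four, and between an original and the copy of another vertex up to the
  value three, because beyond that the detour through the root is as short; two copies are always
  at distance two.
  Since a set is in general position exactly when no three of its members satisfy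
  \<open>d(a,c) = d(a,b) + d(b,c)\<close> (\<open>general_position_iff\<close>), the whole problem becomes one about a
  set \<open>A\<close> of originals and a set \<open>B\<close> of copies and distances in \<open>T\<close>.

  For the lower bound, all original leaves together with the copies of all vertices that are not
  supports work: any two members are at distance two, three or four, so an equation as above can
  only read \<open>4 = 2 + 2\<close>, which would put two leaves of different supports at distance at most
  four in \<open>T\<close>.

  For the upper bound, let \<open>C\<close> be the complement of \<open>B\<close>. One has to show that
  \<open>card A \<le> card C + l - s\<close>. The surplus \<open>l - s\<close> pays for leaves that share a support:
  a set of leaves exceeds the set of its supports by at most \<open>l - s\<close> (\<open>leaf_excess\<close>). What
  remains is to send the leaves of \<open>A\<close> to their supports and the other members of \<open>A\<close> injectively
  to further vertices of \<open>C\<close>; in a tree a vertex that is not a leaf has a child with respect to any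
  root, and distinct vertices have distinct children. If no member of \<open>A\<close> is adjacent to one of
  \<open>B\<close>, then all neighbours of \<open>A\<close> lie in \<open>C\<close> and this can be carried out directly
  (\<open>card_bound_isolated\<close>). If some \<open>v\<close> in \<open>A\<close> is adjacent to a \<open>w\<close> in \<open>B\<close>,
  general position is very restrictive: \<open>B\<close> lies within distance two of \<open>v\<close>, and the rest of
  \<open>A\<close> lies at distance two or three from \<open>v\<close> and outside the branch of \<open>w\<close>. Then members
  of \<open>A\<close> at distance three belong to \<open>C\<close> themselves, those at distance two have a child in
  \<open>C\<close> or are leaves, and one more element of \<open>C\<close> remains for \<open>v\<close>
  (\<open>card_bound_adjacent\<close>). A set containing the root is too small to matter
  (\<open>card_bound_Root\<close>).
\<close>

section \<open>Distances in connected graphs\<close>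

locale connected_pair_graph = pair_graph G for G :: "'a pair_pre_digraph" +
  assumes connected: "u \<in> pverts G \<Longrightarrow> v \<in> pverts G \<Longrightarrow> (u, v) \<in> (parcs G)\<^sup>*"
begin

text \<open>A natural-number version of the distance: it spares the passage through extended reals in all
  the arithmetic that follows; \<open>graph_dist_hops\<close> identifies the two.\<close>

definition hops :: "'a \<Rightarrow> 'a \<Rightarrow> nat" where
  "hops u v = (LEAST k. (u, v) \<in> parcs G ^^ k)"

lemma arc_sym: "(u, v) \<in> parcs G \<Longrightarrow> (v, u) \<in> parcs G"
  using pair_sym_arcs by (auto simp: symmetric_def dest: symD)

lemma arc_neq: "(u, v) \<in> parcs G \<Longrightarrow> u \<noteq> v"
  using pair_no_loops by fastforce

lemma hops_le: "(u, v) \<in> parcs G ^^ k \<Longrightarrow> hops u v \<le> k"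
  unfolding hops_def by (rule Least_le)

lemma hops_walk: "u \<in> pverts G \<Longrightarrow> v \<in> pverts G \<Longrightarrow> (u, v) \<in> parcs G ^^ hops u v"
  unfolding hops_def using connected by (metis LeastI_ex rtrancl_imp_relpow)

lemma hops_refl [simp]: "hops u u = 0"
  using hops_le[of u u 0] by simp

lemma hops_eq_0: "u \<in> pverts G \<Longrightarrow> v \<in> pverts G \<Longrightarrow> hops u v = 0 \<longleftrightarrow> u = v"
  using hops_walk[of u v] by auto

lemma relpow_sym: "(u, v) \<in> parcs G ^^ k \<Longrightarrow> (v, u) \<in> parcs G ^^ k"
proof (induction k arbitrary: v)
  case (Suc k)
  then obtain w where "(u, w) \<in> parcs G ^^ k" "(w, v) \<in> parcs G" by auto
  then show ?case using Suc.IH arc_sym by (metis relpow_Suc_I2)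
qed simp

lemma hops_commute: "hops u v = hops v u"
proof -
  have "(u, v) \<in> parcs G ^^ k \<longleftrightarrow> (v, u) \<in> parcs G ^^ k" for k
    using relpow_sym by blast
  then show ?thesis by (simp add: hops_def)
qed

lemma hops_triangle:
  assumes "u \<in> pverts G" "v \<in> pverts G" "w \<in> pverts G"
  shows "hops u w \<le> hops u v + hops v w"
  using hops_walk[of u v] hops_walk[of v w] assms
  by (intro hops_le) (auto simp: relpow_add)

lemma hops_arc_le:
  assumes "u \<in> pverts G" "(v, w) \<in> parcs G"
  shows "hops u w \<le> Suc (hops u v)"
  using assms hops_walk[of u v] by (intro hops_le) (auto dest: in_arcsD1)

lemma hops_arc: "(u, v) \<in> parcs G \<Longrightarrow> hops u v = 1"
  using hops_arc_le[of u u v] hops_eq_0[of u v] arc_neq[of u v] in_arcsD1[of u v] in_arcsD2[of u v]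
  by simp

lemma hops_eq_1:
  assumes "u \<in> pverts G" "v \<in> pverts G"
  shows "hops u v = 1 \<longleftrightarrow> (u, v) \<in> parcs G"
  using assms hops_walk[of u v] hops_arc[of u v] by auto

lemma closer_neighbour:
  assumes "u \<in> pverts G" "v \<in> pverts G" "u \<noteq> v"
  obtains w where "(v, w) \<in> parcs G" "Suc (hops u w) = hops u v"
proof -
  obtain k where k: "hops u v = Suc k"
    using assms hops_eq_0 not0_implies_Suc by metis
  then obtain w where w: "(u, w) \<in> parcs G ^^ k" "(w, v) \<in> parcs G"
    using hops_walk[OF assms(1,2)] by auto
  then have "hops u w \<le> k" "hops u v \<le> Suc (hops u w)"
    using hops_le hops_arc_le[OF assms(1)] by auto
  then show thesis using that[of w] k w(2) arc_sym by auto
qed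

text \<open>The distance from a fixed vertex is the only function that vanishes there, changes by at most
  one along an arc, and admits a step down at every other vertex. This turns each distance
  computation in the Mycielskian into a local check.\<close>

lemma hops_eqI:
  assumes u: "u \<in> pverts G" "f u = 0" and v: "v \<in> pverts G"
    and lip: "\<And>v w. (v, w) \<in> parcs G \<Longrightarrow> f w \<le> Suc (f v)"
    and down: "\<And>v. v \<in> pverts G \<Longrightarrow> v \<noteq> u \<Longrightarrow> \<exists>w. (v, w) \<in> parcs G \<and> f v = Suc (f w)"
  shows "hops u v = f v"
proof (rule antisym)
  show "hops u v \<le> f v"
    using v
  proof (induction "f v" arbitrary: v)
    case 0
    then show ?case using down[of v] by fastforce
  next
    case (Suc k)
    then obtain w where w: "(v, w) \<in> parcs G" "f v = Suc (f w)"
      using down[of v] u by fastforce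
    then have "hops u w \<le> f w" using Suc by (auto dest: in_arcsD2)
    then show ?case using w hops_arc_le[OF u(1) arc_sym[OF w(1)]] by simp
  qed
  have "f v \<le> k" if "(u, v) \<in> parcs G ^^ k" for k
    using that
  proof (induction k arbitrary: v)
    case (Suc k)
    then obtain w where "(u, w) \<in> parcs G ^^ k" "(w, v) \<in> parcs G" by auto
    then show ?case using Suc.IH lip[of w v] by fastforce
  qed (use u in simp)
  then show "f v \<le> hops u v" using hops_walk u v by blast
qed

lemma relpow_awalk:
  assumes "(u, v) \<in> R ^^ k" "R \<subseteq> parcs G" "u \<in> pverts G"
  shows "\<exists>p. awalk u p v \<and> length p = k \<and> set p \<subseteq> R"
  using assms(1,3)
proof (induction k arbitrary: u)
  case 0
  then show ?case by (auto intro!: exI[of _ "[]"] simp: awalk_Nil_iff)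
next
  case (Suc k)
  then obtain w where w: "(u, w) \<in> R" "(w, v) \<in> R ^^ k" by (meson relpow_Suc_E2)
  then have "w \<in> pverts G" using assms(2) by (auto dest: in_arcsD2)
  with Suc.IH w obtain p where "awalk w p v" "length p = k" "set p \<subseteq> R" by blast
  then show ?case using w assms(2) by (intro exI[of _ "(u, w) # p"]) (auto simp: awalk_Cons_iff)
qed

lemma awalk_relpow: "awalk u p v \<Longrightarrow> (u, v) \<in> parcs G ^^ length p"
proof (induction p arbitrary: u)
  case (Cons e p)
  then obtain w where "e = (u, w)" "(u, w) \<in> parcs G" "(w, v) \<in> parcs G ^^ length p"
    by (cases e) (auto simp: awalk_Cons_iff)
  then show ?case using relpow_Suc_I2 by (metis length_Cons)
qed (simp add: awalk_Nil_iff)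

lemma hops_le_length: "awalk u p v \<Longrightarrow> hops u v \<le> length p"
  by (rule hops_le[OF awalk_relpow])

lemma graph_dist_hops:
  assumes "u \<in> pverts G" "v \<in> pverts G"
  shows "graph_dist G u v = ereal (real (hops u v))"
proof -
  have cost: "awalk_cost (\<lambda>_. 1) p = real (length p)" for p :: "('a \<times> 'a) awalk"
    by (induction p) (auto simp: awalk_cost_def)
  obtain p where p: "awalk u p v" "length p = hops u v"
    using relpow_awalk[OF hops_walk[OF assms]] assms by blast
  have "(INF p\<in>{p. awalk u p v}. ereal (awalk_cost (\<lambda>_. 1) p)) = ereal (real (hops u v))"
    using p hops_le_length by (intro antisym INF_greatest INF_lower2[of p]) (auto simp: cost)
  then show ?thesis by (simp add: graph_dist_def \<mu>_def)
qed

text \<open>Cutting out a closed part of a walk with a repeated vertex would shorten it.\<close>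

lemma shortest_awalk_apath:
  assumes "awalk u p v" "length p = hops u v"
  shows "apath u p v"
proof (rule ccontr)
  assume "\<not> apath u p v"
  then have "\<not> distinct (awalk_verts u p)" using assms by (auto simp: apath_def)
  from awalk_not_distinct_decomp[OF assms(1) this] obtain q r s w where
    *: "p = q @ r @ s" "0 < length r" "awalk u q w" "awalk w s v" by blast
  then have "awalk u (q @ s) v" by (blast intro: awalk_appendI)
  then show False using hops_le_length[of u "q @ s" v] assms * by auto
qed

lemma shortest_path_iff:
  "shortest_path G u p v \<longleftrightarrow> awalk u p v \<and> length p = hops u v"
  using shortest_awalk_apath
  by (auto simp: shortest_path_def apath_def graph_dist_hops dest: awalk_hd_in_verts awalk_last_in_verts)

text \<open>Splitting a geodesic at \<open>x\<close> and then at \<open>y\<close> bounds three distances by the lengths of the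
  parts; as the lengths add up to \<open>hops u v\<close>, the triangle inequality leaves no slack.\<close>

lemma shortest_awalk_hops_add:
  assumes "awalk u (q @ r) v" "length (q @ r) = hops u v" "awalk u q x" "awalk x r v"
    and y: "y \<in> set (awalk_verts x r)"
  shows "hops u y = hops u x + hops x y"
proof -
  obtain r1 r2 where r: "r = r1 @ r2" "awalk x r1 y" "awalk y r2 v"
    using awalk_decomp[OF assms(4) y] by metis
  have "u \<in> pverts G" "v \<in> pverts G" "x \<in> pverts G" "y \<in> pverts G"
    using assms r by (auto dest: awalk_hd_in_verts awalk_last_in_verts)
  then have "hops u v \<le> hops u y + hops y v" "hops u y \<le> hops u x + hops x y"
    by (auto intro: hops_triangle)
  moreover have "hops u x \<le> length q" "hops x y \<le> length r1" "hops y v \<le> length r2"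
    using assms r hops_le_length by auto
  ultimately show ?thesis using assms(2) r(1) by simp
qed

lemma shortest_awalk_hops_diff:
  assumes p: "awalk u p v" "length p = hops u v"
    and x: "x \<in> set (awalk_verts u p)" and y: "y \<in> set (awalk_verts u p)"
    and le: "hops u x \<le> hops u y"
  shows "hops u y = hops u x + hops x y"
proof -
  obtain q r where q: "p = q @ r" "awalk u q x" "awalk x r v"
    using awalk_decomp[OF p(1) x] by metis
  show ?thesis
  proof (cases "y \<in> set (awalk_verts x r)")
    case True
    then show ?thesis using shortest_awalk_hops_add q p by metis
  next
    case False
    then have "y \<in> set (awalk_verts u q)"
      using y q set_awalk_verts_append by auto
    then obtain q1 q2 where q1: "q = q1 @ q2" "awalk u q1 y" "awalk y q2 x"
      using awalk_decomp[OF q(2)] by metis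
    have "x \<in> set (awalk_verts y (q2 @ r))"
      using set_awalk_verts_append q1 q awalk_verts_conv
      by (metis UnI2 awalk_hd_in_verts hd_in_awalk_verts(1))
    moreover have "awalk y (q2 @ r) v" using q1 q by (blast intro: awalk_appendI)
    ultimately have "hops u x = hops u y + hops y x"
      using shortest_awalk_hops_add[of u q1 "q2 @ r" v y x] q1 q p by simp
    moreover from this have "hops y x = 0" using le by simp
    ultimately show ?thesis by (simp add: hops_commute)
  qed
qed

text \<open>A geodesic witnesses additivity of distance along it, and conversely geodesics from
  \<open>a\<close> to \<open>b\<close> and from \<open>b\<close> to \<open>c\<close> with total length \<open>hops a c\<close> concatenate to a geodesic.\<close>

lemma general_position_iff:
  "general_position G S \<longleftrightarrow> S \<subseteq> pverts G \<and>
     (\<forall>a\<in>S. \<forall>b\<in>S. \<forall>c\<in>S. distinct [a, b, c] \<longrightarrow> hops a c \<noteq> hops a b + hops b c)"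
  (is "_ \<longleftrightarrow> _ \<and> ?free")
proof -
  have "\<not> ?free" if sp: "shortest_path G u p v" and "card (S \<inter> set (awalk_verts u p)) \<ge> 3" for u p v
  proof -
    obtain X where "X \<subseteq> S \<inter> set (awalk_verts u p)" "card X = 3"
      using \<open>card _ \<ge> 3\<close> by (meson obtain_subset_with_card_n)
    then obtain x y z where X: "x \<in> S" "y \<in> S" "z \<in> S" "distinct [x, y, z]"
      "{x, y, z} \<subseteq> set (awalk_verts u p)"
      by (auto simp: card_3_iff)
    have ordered: "\<not> ?free"
      if "{a, b, c} \<subseteq> set (awalk_verts u p)" "hops u a \<le> hops u b" "hops u b \<le> hops u c"
        and abc: "a \<in> S" "b \<in> S" "c \<in> S" "distinct [a, b, c]" for a b c
    proof -
      have "hops a c = hops a b + hops b c"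
        using that sp shortest_awalk_hops_diff[of u p v a b] shortest_awalk_hops_diff[of u p v b c]
          shortest_awalk_hops_diff[of u p v a c] by (auto simp: shortest_path_iff)
      then show ?thesis using abc by blast
    qed
    consider "hops u x \<le> hops u y" "hops u y \<le> hops u z" | "hops u x \<le> hops u z" "hops u z \<le> hops u y"
      | "hops u y \<le> hops u x" "hops u x \<le> hops u z" | "hops u y \<le> hops u z" "hops u z \<le> hops u x"
      | "hops u z \<le> hops u x" "hops u x \<le> hops u y" | "hops u z \<le> hops u y" "hops u y \<le> hops u x"
      by linarith
    then show "\<not> ?free"
      by cases (insert X ordered[of x y z] ordered[of x z y] ordered[of y x z] ordered[of y z x]
        ordered[of z x y] ordered[of z y x], auto)
  qed
  moreover have "\<exists>u p v. shortest_path G u p v \<and> card (S \<inter> set (awalk_verts u p)) \<ge> 3"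
    if S: "S \<subseteq> pverts G" and abc: "a \<in> S" "b \<in> S" "c \<in> S" "distinct [a, b, c]"
      and add: "hops a c = hops a b + hops b c" for a b c
  proof -
    obtain p where p: "awalk a p b" "length p = hops a b"
      using relpow_awalk[OF hops_walk[of a b]] abc S by blast
    obtain q where q: "awalk b q c" "length q = hops b c"
      using relpow_awalk[OF hops_walk[of b c]] abc S by blast
    have pq: "awalk a (p @ q) c" using p q by (blast intro: awalk_appendI)
    have "{a, b, c} \<subseteq> set (awalk_verts a (p @ q))"
      using set_awalk_verts_append[OF p(1) q(1)] p q
      by (metis (no_types, lifting) Un_iff empty_subsetI awalkE hd_in_set insert_subset last_in_set awalk_verts_non_Nil)
    then have "card {a, b, c} \<le> card (S \<inter> set (awalk_verts a (p @ q)))"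
      using abc by (intro card_mono) auto
    then have "card (S \<inter> set (awalk_verts a (p @ q))) \<ge> 3" using abc by auto
    moreover have "shortest_path G a (p @ q) c" using pq p q add by (simp add: shortest_path_iff)
    ultimately show ?thesis by blast
  qed
  ultimately show ?thesis unfolding general_position_def awalk_verts_with_proj_eq[symmetric]
    by blast
qed

end

section \<open>Distances in the Mycielskian\<close>

text \<open>Without isolated vertices the Mycielskian is connected: the root is reached from an original
  through the copy of a neighbour.\<close>

locale nontrivial_connected_graph = connected_pair_graph +
  assumes neighbour_ex: "v \<in> pverts G \<Longrightarrow> \<exists>w. (v, w) \<in> parcs G"
begin

lemma myc_arcs [simp]:
  "(Orig u, Orig v) \<in> parcs (mycielskian G) \<longleftrightarrow> (u, v) \<in> parcs G"
  "(Orig u, Copy v) \<in> parcs (mycielskian G) \<longleftrightarrow> (u, v) \<in> parcs G"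
  "(Copy u, Orig v) \<in> parcs (mycielskian G) \<longleftrightarrow> (u, v) \<in> parcs G"
  "(Copy u, Root) \<in> parcs (mycielskian G) \<longleftrightarrow> u \<in> pverts G"
  "(Root, Copy u) \<in> parcs (mycielskian G) \<longleftrightarrow> u \<in> pverts G"
  "(Copy u, Copy v) \<notin> parcs (mycielskian G)"
  "(Orig u, Root) \<notin> parcs (mycielskian G)"
  "(Root, Orig u) \<notin> parcs (mycielskian G)"
  "(Root, Root) \<notin> parcs (mycielskian G)"
  using arc_sym by (auto simp: mycielskian_def)

lemma myc_verts [simp]:
  "Orig u \<in> pverts (mycielskian G) \<longleftrightarrow> u \<in> pverts G"
  "Copy u \<in> pverts (mycielskian G) \<longleftrightarrow> u \<in> pverts G"
  "Root \<in> pverts (mycielskian G)"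
  by (auto simp: mycielskian_def)

lemma connected_mycielskian: "connected_pair_graph (mycielskian G)"
proof -
  interpret M: pair_graph "mycielskian G"
    by (rule pair_graph_mycielskian) (rule pair_graph)
  let ?R = "(parcs (mycielskian G))\<^sup>*"
  have sym: "(b, a) \<in> ?R" if "(a, b) \<in> ?R" for a b
    using that M.pair_sym_arcs by (metis sym_rtrancl symE symmetric_def M.arcs_symmetric symI)
  have root: "(a, Root) \<in> ?R" if in_verts: "a \<in> pverts (mycielskian G)" for a
  proof (cases a)
    case (Orig v)
    then obtain w where "(v, w) \<in> parcs G" using in_verts Orig neighbour_ex by auto
    then have "(Orig v, Copy w) \<in> parcs (mycielskian G)" "(Copy w, Root) \<in> parcs (mycielskian G)"
      by (auto dest: in_arcsD2)
    then show ?thesis using Orig by (meson r_into_rtrancl rtrancl_into_rtrancl)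
  qed (use in_verts in auto)
  show ?thesis
    by unfold_locales (meson root sym rtrancl_trans)
qed

end

sublocale nontrivial_connected_graph \<subseteq> M: connected_pair_graph "mycielskian G"
  by (rule connected_mycielskian)

context nontrivial_connected_graph
begin

text \<open>The distances from an original vertex. The copy of \<open>u\<close> is an exception: it is not adjacent to
  \<open>u\<close> but has the same neighbours in the tree.\<close>

fun myc_dist_from :: "'a \<Rightarrow> 'a myc_vertex \<Rightarrow> nat" where
  "myc_dist_from u (Orig v) = min (hops u v) 4"
| "myc_dist_from u (Copy v) = (if u = v then 2 else min (hops u v) 3)"
| "myc_dist_from u Root = 2"

lemma M_hops_Orig:
  assumes u: "u \<in> pverts G" and x: "x \<in> pverts (mycielskian G)"
  shows "M.hops (Orig u) x = myc_dist_from u x"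
proof (rule M.hops_eqI[OF _ _ x])
  fix x y assume xy: "(x, y) \<in> parcs (mycielskian G)"
  have near: "hops u b \<le> Suc (hops u a)" "hops u a \<le> Suc (hops u b)" if "(a, b) \<in> parcs G" for a b
    using hops_arc_le[OF u that] hops_arc_le[OF u arc_sym[OF that]] by auto
  have adj: "hops u b = 1" if "(u, b) \<in> parcs G" for b using hops_arc[OF that] .
  have pos: "hops u b \<ge> 1" if "b \<in> pverts G" "u \<noteq> b" for b
    using hops_eq_0[OF u that(1)] that(2) by simp
  show "myc_dist_from u y \<le> Suc (myc_dist_from u x)"
  proof (cases x; cases y)
    fix a b assume [simp]: "x = Orig a" "y = Orig b"
    show ?thesis using xy near[of a b] by auto
  next
    fix a b assume [simp]: "x = Orig a" "y = Copy b"
    show ?thesis using xy near[of a b] adj[of a] arc_sym[of a b] by auto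
  next
    fix a b assume [simp]: "x = Copy a" "y = Orig b"
    show ?thesis using xy near[of a b] adj[of b] by auto
  next
    fix a assume [simp]: "x = Copy a" "y = Root"
    show ?thesis using xy pos[of a] by auto
  qed (use xy in auto)
next
  fix x assume x: "x \<in> pverts (mycielskian G)" "x \<noteq> Orig u"
  show "\<exists>w. (x, w) \<in> parcs (mycielskian G) \<and> myc_dist_from u x = Suc (myc_dist_from u w)"
  proof (cases x)
    case (Orig v)
    then obtain w where w: "(v, w) \<in> parcs G" "Suc (hops u w) = hops u v"
      using closer_neighbour[OF u, of v] x by auto
    show ?thesis
    proof (cases "hops u v \<le> 4")
      case True
      then show ?thesis using w Orig by (intro exI[of _ "Orig w"]) auto
    next
      case False
      then show ?thesis using w Orig by (intro exI[of _ "Copy w"]) auto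
    qed
  next
    case (Copy v)
    show ?thesis
    proof (cases "v = u")
      case True
      obtain w where "(u, w) \<in> parcs G" using neighbour_ex u by blast
      then show ?thesis using Copy True hops_arc by (intro exI[of _ "Orig w"]) auto
    next
      case False
      then obtain w where w: "(v, w) \<in> parcs G" "Suc (hops u w) = hops u v"
        using closer_neighbour[OF u, of v] x Copy by auto
      show ?thesis
      proof (cases "hops u v \<le> 3")
        case True
        then show ?thesis using w Copy False by (intro exI[of _ "Orig w"]) auto
      next
        case False
        then show ?thesis using Copy x \<open>v \<noteq> u\<close> by (intro exI[of _ Root]) auto
      qed
    qed
  next
    case Root
    obtain w where "(u, w) \<in> parcs G" using neighbour_ex u by blast
    then show ?thesis using Root hops_arc arc_neq by (intro exI[of _ "Copy w"]) (auto dest: in_arcsD2)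
  qed
qed (use u in auto)

lemma M_hops_Root:
  assumes "u \<in> pverts G"
  shows "M.hops (Orig u) Root = 2" "M.hops Root (Orig u) = 2"
    and "M.hops (Copy u) Root = 1" "M.hops Root (Copy u) = 1"
  using assms by (simp_all add: M_hops_Orig M.hops_commute[of Root "Orig u"] M.hops_arc)

lemma M_hops_simps:
  assumes "u \<in> pverts G" "v \<in> pverts G"
  shows "M.hops (Orig u) (Orig v) = min (hops u v) 4"
    and "M.hops (Orig u) (Copy v) = (if u = v then 2 else min (hops u v) 3)"
    and "M.hops (Copy v) (Orig u) = (if u = v then 2 else min (hops u v) 3)"
    and "M.hops (Copy u) (Copy v) = (if u = v then 0 else 2)"
proof -
  show "M.hops (Copy u) (Copy v) = (if u = v then 0 else 2)"
  proof (cases "u = v")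
    case False
    have "M.hops (Copy u) (Copy v) \<le> M.hops (Copy u) Root + M.hops Root (Copy v)"
      using assms by (intro M.hops_triangle) auto
    moreover have "M.hops (Copy u) Root = 1" "M.hops Root (Copy v) = 1"
      using assms by (simp_all add: M_hops_Root)
    moreover have "M.hops (Copy u) (Copy v) \<noteq> 0" "M.hops (Copy u) (Copy v) \<noteq> 1"
      using assms False M.hops_eq_0[of "Copy u" "Copy v"] M.hops_eq_1[of "Copy u" "Copy v"] by auto
    ultimately show ?thesis using False by simp
  qed simp
qed (use assms in \<open>auto simp: M_hops_Orig M.hops_commute[of _ "Orig u"]\<close>)

end

section \<open>Trees\<close>

text \<open>Trees enter only through this property of the distance, which holds for every choice of the
  root \<open>r\<close>: among the neighbours of a vertex at most one is not strictly farther from \<open>r\<close>.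
  It also excludes edges between vertices at equal distance from \<open>r\<close>.\<close>

locale tree_graph = nontrivial_connected_graph +
  assumes unique_parent: "\<lbrakk>r \<in> pverts G; (w, a) \<in> parcs G; (w, b) \<in> parcs G;
    hops r a \<le> hops r w; hops r b \<le> hops r w\<rbrakk> \<Longrightarrow> a = b"

context connected_pair_graph
begin

text \<open>All vertices on a geodesic to \<open>a\<close> other than its end are closer to \<open>r\<close> than \<open>a\<close>, and therefore
  closer than \<open>w\<close>.\<close>

lemma reach_avoiding:
  assumes "r \<in> pverts G" "w \<in> pverts G" "a \<in> pverts G" "a \<noteq> w" "hops r a \<le> hops r w"
  shows "(r, a) \<in> (parcs G \<inter> (- {w}) \<times> (- {w}))\<^sup>*"
  using assms(3-5)
proof (induction "hops r a" arbitrary: a rule: less_induct)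
  case less
  show ?case
  proof (cases "r = a")
    case False
    obtain b where b: "(a, b) \<in> parcs G" "Suc (hops r b) = hops r a"
      using closer_neighbour[OF assms(1) less.prems(1) False] .
    then have "b \<noteq> w" using less.prems by auto
    then have "(r, b) \<in> (parcs G \<inter> (- {w}) \<times> (- {w}))\<^sup>*"
      using b less.prems by (intro less.hyps) (auto dest: in_arcsD2)
    moreover have "(b, a) \<in> parcs G \<inter> (- {w}) \<times> (- {w})"
      using b \<open>b \<noteq> w\<close> less.prems arc_sym by auto
    ultimately show ?thesis by (rule rtrancl_into_rtrancl)
  qed simp
qed

text \<open>Two different neighbours of \<open>w\<close> that are no farther from \<open>r\<close> than \<open>w\<close> are both reachable from
  \<open>r\<close> without meeting \<open>w\<close>, hence joined by a path that avoids \<open>w\<close>; closing it through \<open>w\<close>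
  gives a cycle.\<close>

lemma acyclic_unique_parent:
  assumes acyclic: "\<not> (\<exists>p. cycle p \<and> length p \<ge> 3)"
    and r: "r \<in> pverts G" and arcs: "(w, a) \<in> parcs G" "(w, b) \<in> parcs G"
    and le: "hops r a \<le> hops r w" "hops r b \<le> hops r w"
  shows "a = b"
proof (rule ccontr)
  assume "a \<noteq> b"
  define R where "R = parcs G \<inter> (- {w}) \<times> (- {w})"
  have "sym R" unfolding R_def using arc_sym by (auto intro!: symI)
  then have "sym (R\<^sup>*)" by (rule sym_rtrancl)
  have verts: "a \<in> pverts G" "b \<in> pverts G" "w \<in> pverts G" "a \<noteq> w" "b \<noteq> w"
    using arcs arc_neq by (auto dest: in_arcsD1 in_arcsD2)
  have "(r, a) \<in> R\<^sup>*" "(r, b) \<in> R\<^sup>*"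
    unfolding R_def using reach_avoiding r verts le by auto
  then have "(a, b) \<in> R\<^sup>*"
    using \<open>sym (R\<^sup>*)\<close> by (meson rtrancl_trans symE)
  then obtain q where q: "awalk a q b" "set q \<subseteq> R"
    using relpow_awalk[where R = R] verts unfolding R_def by (metis inf_le1 rtrancl_imp_relpow)
  define p where "p = awalk_to_apath q"
  have p: "apath a p b" "set p \<subseteq> R"
    using apath_awalk_to_apath[OF q(1)] awalk_to_apath_subset[OF q(1)] q(2) by (auto simp: p_def)
  have aw: "awalk a p b" using p by (simp add: apath_def)
  have "p \<noteq> []" using aw \<open>a \<noteq> b\<close> by (auto simp: awalk_Nil_iff)
  have "w \<notin> set (awalk_verts a p)"
    using set_awalk_verts_not_Nil[OF aw \<open>p \<noteq> []\<close>] p(2) by (auto simp: R_def)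
  moreover have "awalk b [(b, w)] w"
    using arcs arc_sym verts by (auto simp: awalk_Cons_iff awalk_Nil_iff)
  then have pb: "awalk a (p @ [(b, w)]) w" using aw by (blast intro: awalk_appendI)
  moreover have "awalk_verts a (p @ [(b, w)]) = awalk_verts a p @ [w]"
    using awalk_verts_append[OF pb] aw by (auto simp: awalk_verts_conv)
  ultimately have "cycle ((w, a) # p @ [(b, w)])"
    using p(1) verts arcs unfolding cycle_def
    by (intro exI[of _ w]) (auto simp: awalk_Cons_iff apath_def)
  moreover have "length ((w, a) # p @ [(b, w)]) \<ge> 3"
    using \<open>p \<noteq> []\<close> by (cases p) auto
  ultimately show False using acyclic by blast
qed

end

lemma graph_tree_tree_graph:
  assumes tree: "graph_tree T" and card: "card (pverts T) \<ge> 2"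
  shows "tree_graph T"
proof -
  interpret pair_graph T using tree by (simp add: graph_tree_def)
  have sym: "sym (parcs T)" using pair_sym_arcs by (simp add: symmetric_def)
  have mk: "parcs (mk_symmetric (with_proj T)) = parcs T"
  proof
    show "parcs (mk_symmetric (with_proj T)) \<subseteq> parcs T"
      using sym by (auto simp: mk_symmetric_def dest: symD)
    show "parcs T \<subseteq> parcs (mk_symmetric (with_proj T))"
      unfolding mk_symmetric_def by force
  qed
  have "pverts (mk_symmetric (with_proj T)) = pverts T"
    by (simp add: mk_symmetric_def)
  then have reach: "reachable (with_proj (mk_symmetric (with_proj T))) u v"
    if "u \<in> pverts T" "v \<in> pverts T" for u v
    using tree that by (simp add: graph_tree_def connected_def strongly_connected_def)
  interpret connected_pair_graph T
  proof
    fix u v assume "u \<in> pverts T" "v \<in> pverts T"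
    then have "(u, v) \<in> (arcs_ends (with_proj (mk_symmetric (with_proj T))))\<^sup>*"
      by (intro reachable_rtranclI reach)
    then show "(u, v) \<in> (parcs T)\<^sup>*"
      by (simp add: arcs_ends_conv mk)
  qed
  show ?thesis
  proof
    fix v assume v: "v \<in> pverts T"
    have "pverts T \<noteq> {v}" using card by auto
    then obtain u where "u \<in> pverts T" "u \<noteq> v" using v by blast
    then show "\<exists>w. (v, w) \<in> parcs T" using closer_neighbour v by metis
  next
    fix r w a b
    assume "r \<in> pverts T" "(w, a) \<in> parcs T" "(w, b) \<in> parcs T"
      "hops r a \<le> hops r w" "hops r b \<le> hops r w"
    then show "a = b"
      using tree acyclic_unique_parent unfolding graph_tree_def by blast
  qed
qed

context tree_graph
begin

text \<open>A walk in a tree that starts by leaving \<open>r\<close> and never turns back keeps leaving \<open>r\<close>.\<close>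

lemma hops_step_away:
  assumes "r \<in> pverts G" "(w, a) \<in> parcs G" "(w, b) \<in> parcs G" "a \<noteq> b" "hops r a \<le> hops r w"
  shows "hops r b = Suc (hops r w)"
  using unique_parent[OF assms(1-3,5)] assms(4) hops_arc_le[OF assms(1,3)] by linarith

lemma leaf_iff: "v \<in> leaves G \<longleftrightarrow> v \<in> pverts G \<and> (\<exists>!w. (v, w) \<in> parcs G)"
proof -
  have "out_arcs (with_proj G) v = Pair v ` {w. (v, w) \<in> parcs G}" by (auto simp: out_arcs_def)
  then have "out_degree (with_proj G) v = card {w. (v, w) \<in> parcs G}"
    by (simp add: out_degree_def card_image inj_on_def)
  then show ?thesis
    by (auto simp: leaves_def card_1_singleton_iff set_eq_iff)
qed

lemma leaf_unique: "v \<in> leaves G \<Longrightarrow> (v, a) \<in> parcs G \<Longrightarrow> (v, b) \<in> parcs G \<Longrightarrow> a = b"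
  using leaf_iff by auto

lemma other_neighbour:
  assumes "v \<in> pverts G" "v \<notin> leaves G"
  obtains w where "(v, w) \<in> parcs G" "w \<noteq> a"
  using assms leaf_iff neighbour_ex by metis

lemma farther_neighbour:
  assumes "r \<in> pverts G" "v \<in> pverts G" "v \<notin> leaves G"
  obtains w where "(v, w) \<in> parcs G" "hops r w = Suc (hops r v)"
proof -
  obtain a where a: "(v, a) \<in> parcs G" using neighbour_ex assms by blast
  obtain b where b: "(v, b) \<in> parcs G" "b \<noteq> a" using other_neighbour assms by metis
  show thesis
    using hops_step_away[OF assms(1) a b(1)] hops_arc_le[OF assms(1) a] a b that
    by (metis le_SucE)
qed

text \<open>The support vertex of a leaf, unspecified for other vertices.\<close>

definition stem :: "'a \<Rightarrow> 'a" where
  "stem l = (THE y. (l, y) \<in> parcs G)"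

lemma stem_arc: "l \<in> leaves G \<Longrightarrow> (l, stem l) \<in> parcs G"
  unfolding stem_def leaf_iff using theI'[of "\<lambda>y. (l, y) \<in> parcs G"] by blast

lemma stem_eq: "l \<in> leaves G \<Longrightarrow> (l, y) \<in> parcs G \<Longrightarrow> stem l = y"
  using leaf_unique stem_arc by blast

lemma leaves_at_iff: "l \<in> leaves_at G y \<longleftrightarrow> l \<in> leaves G \<and> stem l = y"
  using stem_arc stem_eq arc_sym unfolding leaves_at_def by blast

lemma support_vertices_stem: "support_vertices G = stem ` leaves G"
  using stem_arc unfolding support_vertices_def
  by (auto simp: leaves_at_iff dest: in_arcsD2)

lemma finite_leaves [simp]: "finite (leaves G)"
  using pair_finite_verts by (simp add: leaves_def)

text \<open>The leaves outside \<open>X\<close> have to serve all supports that have no leaf in \<open>X\<close>, so there are at least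
  that many of them.\<close>

lemma leaf_excess:
  assumes "X \<subseteq> leaves G"
  shows "card X + card (support_vertices G) \<le> card (leaves G) + card (stem ` X)"
proof -
  have fin: "finite X" using assms finite_leaves by (rule Finite_Set.finite_subset)
  have "support_vertices G \<subseteq> stem ` X \<union> stem ` (leaves G - X)"
    by (auto simp: support_vertices_stem)
  then have "card (support_vertices G) \<le> card (stem ` X \<union> stem ` (leaves G - X))"
    using fin by (intro card_mono) auto
  also have "\<dots> \<le> card (stem ` X) + card (leaves G - X)"
    using card_Un_le card_image_le[of "leaves G - X" stem] finite_leaves
    by (meson add_left_mono finite_Diff le_trans)
  finally show ?thesis using assms fin card_mono[OF finite_leaves assms]
    by (simp add: card_Diff_subset)
qed

lemma leaf_dist_hops:
  assumes "leaf_dist G \<ge> 5" "l \<in> leaves G" "l' \<in> leaves G" "stem l \<noteq> stem l'"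
  shows "hops l l' \<ge> 5"
proof -
  let ?D = "{graph_dist G l l' | l l' y y'. y \<in> support_vertices G \<and> y' \<in> support_vertices G \<and>
    y \<noteq> y' \<and> l \<in> leaves_at G y \<and> l' \<in> leaves_at G y'}"
  have "?D \<subseteq> (\<lambda>(l, l'). graph_dist G l l') ` (leaves G \<times> leaves G)"
    by (auto simp: leaves_at_iff)
  then have "finite ?D" by (rule Finite_Set.finite_subset) simp
  moreover have "graph_dist G l l' \<in> ?D"
    using assms by (auto simp: leaves_at_iff support_vertices_stem)
  ultimately have "leaf_dist G \<le> graph_dist G l l'"
    unfolding leaf_dist_def by (rule Min_le)
  moreover have "l \<in> pverts G" "l' \<in> pverts G" using assms by (auto simp: leaves_def)
  ultimately have "5 \<le> ereal (real (hops l l'))"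
    using assms(1) order_trans by (fastforce simp: graph_dist_hops)
  then show ?thesis by simp
qed

end

section \<open>Trees with distant leaves\<close>

locale distant_leaf_tree = tree_graph +
  assumes distant: "\<lbrakk>l \<in> leaves G; l' \<in> leaves G; stem l \<noteq> stem l'\<rbrakk> \<Longrightarrow> hops l l' \<ge> 5"
    and two_supports: "\<exists>l\<in>leaves G. \<exists>l'\<in>leaves G. stem l \<noteq> stem l'"
begin

lemma leaf_in_verts: "l \<in> leaves G \<Longrightarrow> l \<in> pverts G"
  by (simp add: leaf_iff)

lemma same_stem_hops:
  assumes "l \<in> leaves G" "l' \<in> leaves G" "stem l = stem l'" "l \<noteq> l'"
  shows "hops l l' = 2"
proof -
  have "(l, stem l) \<in> parcs G" "(stem l, l') \<in> parcs G"
    using assms stem_arc arc_sym by metis+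
  then have "hops l l' = Suc (hops l (stem l))"
    using assms hops_step_away[of l "stem l" l l'] leaf_in_verts arc_sym by simp
  then show ?thesis using hops_arc[OF stem_arc[OF assms(1)]] by simp
qed

section \<open>A large general position set\<close>

definition extremal_set :: "'a myc_vertex set" where
  "extremal_set = Orig ` leaves G \<union> Copy ` (pverts G - support_vertices G)"

lemma leaf_nonsupport_hops:
  assumes "l \<in> leaves G" "v \<in> pverts G" "v \<notin> support_vertices G" "v \<noteq> l"
  shows "hops l v \<ge> 2"
proof -
  have "hops l v \<noteq> 0" using assms hops_eq_0 leaf_in_verts by metis
  moreover have "hops l v \<noteq> 1"
    using assms hops_eq_1[of l v] leaf_in_verts stem_eq support_vertices_stem by blast
  ultimately show ?thesis by simp
qed

text \<open>The smallest distance between two members is two, and a distance of four occurs only between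
  leaves with different supports. So only a member at distance two from two such leaves could
  be between them; it would bring the leaves within distance four in the tree.\<close>

lemma general_position_extremal_set: "general_position (mycielskian G) extremal_set"
proof -
  have sub: "extremal_set \<subseteq> pverts (mycielskian G)"
    by (auto simp: extremal_set_def leaf_in_verts)
  have far: "M.hops x y \<ge> 2" if "x \<in> extremal_set" "y \<in> extremal_set" "x \<noteq> y" for x y
  proof (cases x; cases y)
    fix l l' assume [simp]: "x = Orig l" "y = Orig l'"
    have "l \<in> leaves G" "l' \<in> leaves G" "l \<noteq> l'" using that by (auto simp: extremal_set_def)
    then show ?thesis
      using same_stem_hops[of l l'] distant[of l l']
      by (cases "stem l = stem l'") (simp_all add: M_hops_simps leaf_in_verts)
  next
    fix l v assume [simp]: "x = Orig l" "y = Copy v"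
    have "l \<in> leaves G" "v \<in> pverts G - support_vertices G"
      using that by (auto simp: extremal_set_def)
    then show ?thesis
      using leaf_nonsupport_hops[of l v] by (simp add: M_hops_simps leaf_in_verts)
  next
    fix l v assume [simp]: "x = Copy v" "y = Orig l"
    have "l \<in> leaves G" "v \<in> pverts G - support_vertices G"
      using that by (auto simp: extremal_set_def)
    then show ?thesis
      using leaf_nonsupport_hops[of l v] by (simp add: M_hops_simps leaf_in_verts)
  next
    fix u v assume [simp]: "x = Copy u" "y = Copy v"
    have "u \<in> pverts G" "v \<in> pverts G" "u \<noteq> v"
      using that by (auto simp: extremal_set_def)
    then show ?thesis by (simp add: M_hops_simps)
  qed (use that in \<open>auto simp: extremal_set_def\<close>)
  have near: "M.hops x y \<le> 3"
    if "x \<in> extremal_set" "y \<in> extremal_set" "x \<notin> range Orig \<or> y \<notin> range Orig" for x y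
    using that by (auto simp: extremal_set_def M_hops_simps leaf_in_verts)
  have "M.hops x z \<noteq> M.hops x y + M.hops y z"
    if S: "x \<in> extremal_set" "y \<in> extremal_set" "z \<in> extremal_set" and d: "distinct [x, y, z]" for x y z
  proof
    assume add: "M.hops x z = M.hops x y + M.hops y z"
    have ge: "M.hops x y \<ge> 2" "M.hops y z \<ge> 2" using far S d by auto
    then have "x \<in> range Orig" "z \<in> range Orig" using near[of x z] add S by auto
    then obtain l l' where l: "x = Orig l" "z = Orig l'" "l \<in> leaves G" "l' \<in> leaves G" "l \<noteq> l'"
      using S d by (auto simp: extremal_set_def)
    then have xz: "M.hops x z = min (hops l l') 4" by (simp add: M_hops_simps leaf_in_verts)
    then have st: "stem l \<noteq> stem l'" using same_stem_hops[of l l'] l add ge by auto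
    then have five: "hops l l' \<ge> 5" using distant l by simp
    have eq: "M.hops x y = 2" "M.hops y z = 2" using xz five add ge by auto
    obtain v where v: "y = Orig v \<or> y = Copy v" "v \<in> pverts G"
      using S by (auto simp: extremal_set_def leaf_in_verts)
    have "hops l v = 2 \<or> l = v" "hops l' v = 2 \<or> l' = v" "v = l \<or> v = l' \<Longrightarrow> y = Copy v"
      using eq v l d hops_commute[of v l']
      by (auto simp: M_hops_simps leaf_in_verts min_def split: if_splits)
    moreover have "hops l l' \<le> hops l v + hops l' v"
      using hops_triangle[of l v l'] v l leaf_in_verts hops_commute[of v l'] by simp
    moreover have "hops l v \<noteq> hops l' v \<or> v \<noteq> l" using five by (auto simp: hops_commute)
    ultimately show False
      using five eq l v hops_commute[of l l'] by (auto simp: M_hops_simps leaf_in_verts)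
  qed
  then show ?thesis using sub by (simp add: M.general_position_iff)
qed

lemma support_vertices_subset: "support_vertices G \<subseteq> pverts G"
  by (auto simp: support_vertices_def)

lemma card_extremal_set:
  "card extremal_set + card (support_vertices G) = card (pverts G) + card (leaves G)"
proof -
  have "card extremal_set = card (leaves G) + card (pverts G - support_vertices G)"
    unfolding extremal_set_def using pair_finite_verts
    by (subst card_Un_disjoint) (auto simp: card_image inj_on_def)
  moreover have "card (pverts G - support_vertices G) + card (support_vertices G) = card (pverts G)"
    using card_Diff_subset[OF _ support_vertices_subset] card_mono[OF pair_finite_verts support_vertices_subset]
      Finite_Set.finite_subset[OF support_vertices_subset pair_finite_verts] by simp
  ultimately show ?thesis by simp
qed

end

section \<open>General position sets are not larger\<close>

locale myc_general_position = distant_leaf_tree +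
  fixes S :: "'a myc_vertex set"
  assumes gp_S: "general_position (mycielskian G) S"
begin

text \<open>The traces of \<open>S\<close> on the originals and on the copies, both taken back to the tree.\<close>

definition A :: "'a set" where "A = {v. Orig v \<in> S}"

definition B :: "'a set" where "B = {v. Copy v \<in> S}"

lemma S_sub: "S \<subseteq> pverts (mycielskian G)"
  using gp_S by (simp add: M.general_position_iff)

lemma A_sub: "A \<subseteq> pverts G" and B_sub: "B \<subseteq> pverts G"
  using S_sub by (auto simp: A_def B_def)

lemma not_between:
  "\<lbrakk>x \<in> S; y \<in> S; z \<in> S; x \<noteq> y; y \<noteq> z; x \<noteq> z\<rbrakk> \<Longrightarrow> M.hops x z \<noteq> M.hops x y + M.hops y z"
  using gp_S by (simp add: M.general_position_iff)

lemma finite_A [simp]: "finite A" and finite_B [simp]: "finite B"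
  using A_sub B_sub pair_finite_verts Finite_Set.finite_subset by blast+

lemma card_S: "card S \<le> card A + card B + card (S \<inter> {Root})"
proof -
  have "S = Orig ` A \<union> Copy ` B \<union> (S \<inter> {Root})"
  proof (rule set_eqI)
    fix x show "x \<in> S \<longleftrightarrow> x \<in> Orig ` A \<union> Copy ` B \<union> (S \<inter> {Root})"
      by (cases x) (auto simp: A_def B_def)
  qed
  then have "card S \<le> card (Orig ` A) + card (Copy ` B) + card (S \<inter> {Root})"
    using card_Un_le by (metis (no_types, lifting) add_le_mono1 le_trans)
  then show ?thesis by (simp add: card_image inj_on_def)
qed

text \<open>Replacing the first inner vertex of a path in the tree by its copy does not change the length.
  Hence the copy of the neighbour \<open>a\<close> lies between \<open>v\<close> and \<open>u\<close>, also when the distance is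
  truncated; if \<open>a = u\<close>, it is \<open>v\<close> that lies between \<open>u\<close> and its copy.\<close>

lemma toward_notin_B:
  assumes "u \<in> A" "v \<in> A" "(v, a) \<in> parcs G" "Suc (hops u a) = hops u v"
  shows "a \<notin> B"
proof
  assume "a \<in> B"
  then have S: "Orig u \<in> S" "Orig v \<in> S" "Copy a \<in> S" using assms by (auto simp: A_def B_def)
  have V: "u \<in> pverts G" "v \<in> pverts G" "a \<in> pverts G"
    using assms A_sub by (auto dest: in_arcsD2)
  have "hops v a = 1" "v \<noteq> a" using hops_arc arc_neq assms by auto
  moreover have "u \<noteq> v" using assms by auto
  ultimately show False
    using not_between[OF S(2,3,1)] not_between[OF S(3,2,1)] V assms(4) hops_commute[of v u]
    by (cases "u = a") (auto simp: M_hops_simps)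
qed

text \<open>At distance four or more the path through the root is a geodesic from \<open>v\<close> to \<open>u\<close>, and it may
  start with the copy of any neighbour of \<open>v\<close>.\<close>

lemma far_notin_B:
  assumes "u \<in> A" "v \<in> A" "(v, a) \<in> parcs G" "hops u v \<ge> 4"
  shows "a \<notin> B"
proof
  assume "a \<in> B"
  then have S: "Orig u \<in> S" "Orig v \<in> S" "Copy a \<in> S" using assms by (auto simp: A_def B_def)
  have V: "u \<in> pverts G" "v \<in> pverts G" "a \<in> pverts G"
    using assms A_sub by (auto dest: in_arcsD2)
  have "hops v a = 1" "v \<noteq> a" using hops_arc arc_neq assms by auto
  moreover have "u \<noteq> v" using assms by auto
  moreover have "hops u a \<ge> 3" using hops_arc_le[OF V(1) arc_sym[OF assms(3)]] assms(4) by simp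
  moreover from this have "u \<noteq> a" by auto
  ultimately show False
    using not_between[OF S(2,3,1)] V assms(4) hops_commute[of v u]
    by (auto simp: M_hops_simps)
qed

text \<open>The path from \<open>u\<close> over \<open>v\<close> to the copy of \<open>a\<close> is a geodesic, because a tree has no triangle.\<close>

lemma adjacent_notin_B:
  assumes "u \<in> A" "v \<in> A" "(v, a) \<in> parcs G" "(u, v) \<in> parcs G"
  shows "a \<notin> B"
proof (cases "a = u")
  case True
  then show ?thesis using toward_notin_B[OF assms(1-3)] hops_arc[OF assms(4)] by simp
next
  case False
  have S: "Orig u \<in> S" "Orig v \<in> S" using assms by (auto simp: A_def)
  have V: "u \<in> pverts G" "v \<in> pverts G" "a \<in> pverts G"
    using assms A_sub by (auto dest: in_arcsD2)
  have "hops u v = 1" "hops v a = 1" "u \<noteq> v" "v \<noteq> a" using hops_arc arc_neq assms by auto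
  moreover from this have "hops u a = 2"
    using hops_step_away[OF V(1) arc_sym[OF assms(4)] assms(3)] False by simp
  ultimately show ?thesis
    using not_between[OF S, of "Copy a"] V False by (auto simp: M_hops_simps B_def)
qed

text \<open>A copy \<open>x\<close> far from \<open>v\<close> is at distance three in the Mycielskian, and the copy of \<open>w\<close> followed
  by the root leads there.\<close>

lemma B_radius:
  assumes "v \<in> A" "w \<in> B" "(v, w) \<in> parcs G" "x \<in> B"
  shows "hops v x \<le> 2"
proof (rule ccontr)
  assume "\<not> hops v x \<le> 2"
  have S: "Orig v \<in> S" "Copy w \<in> S" "Copy x \<in> S" using assms by (auto simp: A_def B_def)
  have V: "v \<in> pverts G" "w \<in> pverts G" "x \<in> pverts G"
    using assms A_sub B_sub by auto
  have "hops v w = 1" "v \<noteq> w" using hops_arc arc_neq assms by auto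
  moreover have "x \<noteq> w" "x \<noteq> v" using \<open>\<not> hops v x \<le> 2\<close> calculation by auto
  ultimately show False
    using not_between[OF S] V \<open>\<not> hops v x \<le> 2\<close> by (auto simp: M_hops_simps)
qed

lemma A_not_between:
  assumes "a \<in> A" "b \<in> A" "c \<in> A" "a \<noteq> b" "b \<noteq> c" "a \<noteq> c" "hops a c \<le> 4"
  shows "hops a c \<noteq> hops a b + hops b c"
proof -
  have S: "Orig a \<in> S" "Orig b \<in> S" "Orig c \<in> S" using assms by (auto simp: A_def)
  have "a \<in> pverts G" "b \<in> pverts G" "c \<in> pverts G" using assms A_sub by auto
  then show ?thesis
    using not_between[OF S] assms by (auto simp: M_hops_simps)
qed

text \<open>The root lies between any two copies.\<close>

lemma Root_card_B:
  assumes "Root \<in> S"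
  shows "card B \<le> 1"
proof -
  have "a = b" if "a \<in> B" "b \<in> B" for a b
  proof (rule ccontr)
    assume "a \<noteq> b"
    then show False
      using not_between[OF _ assms, of "Copy a" "Copy b"] that B_sub
      by (auto simp: B_def M_hops_Root M_hops_simps subset_iff)
  qed
  then show ?thesis by (metis card_le_Suc0_iff_eq finite_B One_nat_def)
qed

text \<open>The root lies between two originals as soon as their distance is the maximal one.\<close>

lemma Root_diameter_A:
  assumes "Root \<in> S" "a \<in> A" "b \<in> A"
  shows "hops a b < 4"
proof (rule ccontr)
  assume "\<not> hops a b < 4"
  moreover from this have "a \<noteq> b" by auto
  ultimately show False
    using not_between[OF _ assms(1), of "Orig a" "Orig b"] assms A_sub
    by (auto simp: A_def M_hops_Root M_hops_simps subset_iff)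
qed

text \<open>Two leaves \<open>l\<close>, \<open>l'\<close> with different supports \<open>y\<close>, \<open>y'\<close> give two disjoint pairs \<open>l, y'\<close> and
  \<open>y, l'\<close> at distance at least four; each pair has a member outside \<open>A\<close>.\<close>

lemma card_bound_Root:
  assumes "Root \<in> S"
  shows "card A + card B + 1 \<le> card (pverts G)"
proof -
  obtain l l' where l: "l \<in> leaves G" "l' \<in> leaves G" "stem l \<noteq> stem l'"
    using two_supports by blast
  define y y' where "y = stem l" and "y' = stem l'"
  have arcs: "(l, y) \<in> parcs G" "(l', y') \<in> parcs G" using stem_arc l by (auto simp: y_def y'_def)
  have V: "l \<in> pverts G" "l' \<in> pverts G" "y \<in> pverts G" "y' \<in> pverts G"
    using arcs by (auto dest: in_arcsD1 in_arcsD2)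
  have 1: "hops l l' \<ge> 5" using distant l by simp
  then have 2: "hops l y' \<ge> 4" using hops_arc_le[OF V(1) arc_sym[OF arcs(2)]] by simp
  have 3: "hops y l' \<ge> 4"
    using hops_arc_le[OF V(2) arc_sym[OF arcs(1)]] 1 hops_commute[of l'] by simp
  have ne: "l \<noteq> l'" "l \<noteq> y" "l' \<noteq> y'" "y \<noteq> y'" "l \<noteq> y'" "y \<noteq> l'"
    using 1 2 3 arc_neq arcs l by (auto simp: y_def y'_def)
  have "\<not> (l \<in> A \<and> y' \<in> A)" "\<not> (y \<in> A \<and> l' \<in> A)"
    using Root_diameter_A[OF assms] 2 3 by fastforce+
  then obtain a b where ab: "a \<notin> A" "b \<notin> A" "a \<noteq> b" "{a, b} \<subseteq> pverts G"
    using ne V by (metis bot.extremum insert_subset)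
  then have "card (insert a (insert b A)) \<le> card (pverts G)"
    using A_sub pair_finite_verts by (intro card_mono) auto
  then show ?thesis using Root_card_B[OF assms] ab by simp
qed

text \<open>Leaves of \<open>A\<close> go to their supports \<open>Y\<close>, the surplus being covered by \<open>leaf_excess\<close>. Any other \<open>v\<close> in \<open>A\<close> goes to a neighbour outside \<open>Y\<close>.
  If \<open>v\<close> is next to a support in \<open>Y\<close>, any other neighbour \<open>w\<close> of \<open>v\<close> will do: \<open>w\<close> is not
  in \<open>Y\<close> since supports are at distance at least three, and no other \<open>v'\<close> in \<open>A\<close> that is not
  a leaf is next to \<open>w\<close>, since the leaf behind the support, \<open>v\<close> and \<open>v'\<close> would be the start,
  the middle and the end of a path of length four. Otherwise \<open>v\<close> goes to a child with respect to
  a fixed root \<open>r\<close>.\<close>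

lemma card_bound_isolated:
  assumes isol: "\<And>v w. v \<in> A \<Longrightarrow> (v, w) \<in> parcs G \<Longrightarrow> w \<notin> B"
  shows "card A + card B + card (support_vertices G) \<le> card (pverts G) + card (leaves G)"
proof -
  define Y where "Y = stem ` (A \<inter> leaves G)"
  obtain r where r: "r \<in> pverts G" using two_supports leaf_in_verts by blast
  have "\<exists>w. (v, w) \<in> parcs G \<and> w \<notin> Y \<and> ((\<exists>y\<in>Y. (v, y) \<in> parcs G) \<or> hops r w = Suc (hops r v))"
    if v: "v \<in> A - leaves G" for v
  proof (cases "\<exists>y\<in>Y. (v, y) \<in> parcs G")
    case True
    then obtain l where l: "l \<in> leaves G" "(v, stem l) \<in> parcs G" by (auto simp: Y_def)
    obtain w where w: "(v, w) \<in> parcs G" "w \<noteq> stem l" using other_neighbour v A_sub by blast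
    have "w \<noteq> stem l'" if l': "l' \<in> leaves G" for l'
    proof
      assume wl: "w = stem l'"
      have V: "l \<in> pverts G" using l leaf_in_verts by blast
      have "hops l v \<le> 2" "hops l w \<le> Suc (hops l v)" "hops l l' \<le> Suc (hops l w)"
        using hops_arc_le[OF V arc_sym[OF l(2)]] hops_arc[OF stem_arc[OF l(1)]]
          hops_arc_le[OF V w(1)] hops_arc_le[OF V arc_sym[OF stem_arc[OF l']]] wl by auto
      then show False using distant[OF l(1) l'] w wl by simp
    qed
    then have "w \<notin> Y" by (auto simp: Y_def)
    then show ?thesis using w True by blast
  next
    case False
    obtain w where "(v, w) \<in> parcs G" "hops r w = Suc (hops r v)"
      using farther_neighbour[OF r] v A_sub by blast
    then show ?thesis using False by blast
  qed
  then obtain h where h: "\<And>v. v \<in> A - leaves G \<Longrightarrow> (v, h v) \<in> parcs G \<and> h v \<notin> Y \<and>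
      ((\<exists>y\<in>Y. (v, y) \<in> parcs G) \<or> hops r (h v) = Suc (hops r v))"
    by metis
  have no_neighbour_in_Y: "\<not> (\<exists>y\<in>Y. (v, y) \<in> parcs G)"
    if v: "v \<in> A - leaves G" "v' \<in> A - leaves G" "v \<noteq> v'" "h v = h v'" for v v'
  proof
    assume "\<exists>y\<in>Y. (v, y) \<in> parcs G"
    then obtain l where l: "l \<in> A" "l \<in> leaves G" "(v, stem l) \<in> parcs G" "stem l \<in> Y" by (auto simp: Y_def)
    have V: "l \<in> pverts G" using l leaf_in_verts by blast
    have "v \<noteq> l" using v l by auto
    have "hops l (stem l) = 1" using hops_arc[OF stem_arc[OF l(2)]] .
    then have 2: "hops l v = 2"
      using hops_step_away[OF V arc_sym[OF stem_arc[OF l(2)]] arc_sym[OF l(3)]] \<open>v \<noteq> l\<close> by simp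
    have "h v \<noteq> stem l" using h v l by metis
    then have 3: "hops l (h v) = 3"
      using hops_step_away[OF V l(3), of "h v"] h[OF v(1)] 2 \<open>hops l (stem l) = 1\<close> by auto
    have vw: "(h v, v) \<in> parcs G" "(h v, v') \<in> parcs G" using h v arc_sym by metis+
    then have 4: "hops l v' = 4"
      using hops_step_away[OF V vw v(3)] 2 3 by simp
    have "hops v v' \<le> 2"
      using hops_arc_le[of v "h v" v'] hops_arc[OF arc_sym[OF vw(1)]] vw v A_sub by auto
    moreover have "hops l v' \<le> hops l v + hops v v'"
      using hops_triangle V v A_sub by blast
    ultimately have "hops l v' = hops l v + hops v v'" using 2 4 by simp
    then show False using A_not_between[of l v v'] l v 2 4 by auto
  qed
  have "inj_on h (A - leaves G)"
  proof (rule inj_onI, rule ccontr)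
    fix v v' assume v: "v \<in> A - leaves G" "v' \<in> A - leaves G" "h v = h v'" "v \<noteq> v'"
    then have "hops r (h v) = Suc (hops r v)" "hops r (h v) = Suc (hops r v')"
      using no_neighbour_in_Y[of v v'] no_neighbour_in_Y[of v' v] h by metis+
    then show False using unique_parent[OF r, of "h v" v v'] h v arc_sym by (metis le_SucI order_refl)
  qed
  moreover have "h ` (A - leaves G) \<subseteq> pverts G - B - Y"
    using h isol by (blast dest: in_arcsD2)
  ultimately have "card (A - leaves G) \<le> card (pverts G - B - Y)"
    using pair_finite_verts by (metis card_image card_mono finite_Diff)
  moreover have Y: "Y \<subseteq> pverts G - B"
    using isol stem_arc by (auto simp: Y_def dest: in_arcsD2)
  then have "card (pverts G - B - Y) + card Y + card B = card (pverts G)"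
    using B_sub pair_finite_verts card_mono[OF _ Y] card_mono[OF _ B_sub]
    by (simp add: card_Diff_subset Finite_Set.finite_subset)
  moreover have "card (A \<inter> leaves G) + card (support_vertices G) \<le> card (leaves G) + card Y"
    unfolding Y_def by (rule leaf_excess) simp
  moreover have "card A = card (A \<inter> leaves G) + card (A - leaves G)"
    using card_Int_Diff by (metis finite_A)
  ultimately show ?thesis by linarith
qed

text \<open>Everything is measured from \<open>v\<close>. The members of \<open>A\<close> at distance three (\<open>A3\<close>) lie outside \<open>B\<close>.
  Those at distance two that are not leaves (\<open>N\<close>) are sent to a child \<open>f u\<close>, which is outside \<open>A\<close>
  because \<open>u\<close> would be between \<open>v\<close> and \<open>f u\<close>. Those at distance two that are leaves (\<open>L\<close>) are
  accounted for by their supports, which are outside \<open>B\<close>. All these vertices of the complement of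
  \<open>B\<close> are distinct, and a further one is needed for \<open>v\<close> itself.\<close>

lemma card_bound_adjacent:
  assumes v: "v \<in> A" and w: "w \<in> B" and vw: "(v, w) \<in> parcs G"
  shows "card A + card B + card (support_vertices G) \<le> card (pverts G) + card (leaves G)"
proof -
  have V: "v \<in> pverts G" "w \<in> pverts G" using v w A_sub B_sub by auto
  \<comment> \<open>Seen from \<open>v\<close>, another member of \<open>A\<close> lies behind a neighbour \<open>p\<close> outside \<open>B\<close>, hence not
    behind \<open>w\<close>.\<close>
  have away: "\<exists>p. (v, p) \<in> parcs G \<and> p \<notin> B \<and> Suc (hops u p) = hops u v \<and> hops w u = Suc (hops v u)"
    if u: "u \<in> A" "u \<noteq> v" for u
  proof -
    have uV: "u \<in> pverts G" using u A_sub by auto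
    obtain p where p: "(v, p) \<in> parcs G" "Suc (hops u p) = hops u v"
      using closer_neighbour[OF uV V(1) u(2)] .
    have "p \<notin> B" using toward_notin_B u v p by blast
    moreover have "hops u w = Suc (hops u v)"
      using hops_step_away[OF uV p(1) vw] p \<open>p \<notin> B\<close> w by auto
    ultimately show ?thesis using p by (auto simp: hops_commute[of u])
  qed
  have dist: "hops v u = 2 \<or> hops v u = 3" if u: "u \<in> A" "u \<noteq> v" for u
  proof -
    have uV: "u \<in> pverts G" using u A_sub by auto
    have "hops v u \<noteq> 0" using hops_eq_0[OF V(1) uV] u by auto
    moreover have "hops v u \<noteq> 1"
      using hops_eq_1[OF V(1) uV] adjacent_notin_B[OF u(1) v vw] arc_sym w by auto
    moreover have "hops v u < 4"
      using far_notin_B[OF u(1) v vw] w hops_commute[of u v] by (metis not_less)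
    ultimately show ?thesis by linarith
  qed
  define L where "L = {u \<in> A \<inter> leaves G. hops v u = 2}"
  define N where "N = {u \<in> A - leaves G. hops v u = 2}"
  define A3 where "A3 = {u \<in> A. hops v u = 3}"
  have A_eq: "A \<subseteq> {v} \<union> A3 \<union> N \<union> L"
    using dist by (auto simp: L_def N_def A3_def)
  have fin: "finite L" "finite N" "finite A3"
    by (auto simp: L_def N_def A3_def)
  have "\<exists>c. (u, c) \<in> parcs G \<and> hops v c = 3" if "u \<in> N" for u
    using farther_neighbour[OF V(1), of u] that A_sub by (auto simp: N_def)
  then obtain f where f: "\<And>u. u \<in> N \<Longrightarrow> (u, f u) \<in> parcs G \<and> hops v (f u) = 3" by metis
  have f_unique: "x = u" if "u \<in> N" "(x, f u) \<in> parcs G" "hops v x = 2" for u x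
    using unique_parent[OF V(1), of "f u" x u] f[OF that(1)] that arc_sym by (auto simp: N_def)
  then have "inj_on f N" using f by (intro inj_onI) (metis (mono_tags, lifting) N_def mem_Collect_eq)
  have f_A: "f u \<notin> A" if u: "u \<in> N" for u
  proof
    assume "f u \<in> A"
    moreover have "hops u (f u) = 1" "u \<noteq> f u" using f[OF u] hops_arc arc_neq by auto
    moreover have "v \<noteq> u" "v \<noteq> f u" using f[OF u] u by (auto simp: N_def)
    ultimately show False
      using A_not_between[of v u "f u"] f[OF u] u v by (auto simp: N_def)
  qed
  have far_C: "x \<notin> B" if "hops v x \<ge> 3" for x
    using B_radius[OF v w vw] that by fastforce
  have P: "stem l \<notin> B \<and> (v, stem l) \<in> parcs G" if l: "l \<in> L" for l
  proof -
    have lA: "l \<in> A" "l \<in> leaves G" "hops v l = 2" "l \<noteq> v" using l by (auto simp: L_def)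
    obtain p where p: "(v, p) \<in> parcs G" "p \<notin> B" "Suc (hops l p) = hops l v" using away[OF lA(1,4)] by blast
    then have "hops l p = 1" using lA by (simp add: hops_commute)
    then have "(l, p) \<in> parcs G" using hops_eq_1[of l p] lA p leaf_in_verts by (auto dest: in_arcsD2)
    then show ?thesis using stem_eq lA p by auto
  qed
  \<comment> \<open>The vertex \<open>e\<close> that pays for \<open>v\<close>. If \<open>L\<close> has an element, neither \<open>w\<close> nor its child can be
    a leaf, so the branch of \<open>w\<close> contains a vertex \<open>z\<close> at distance three from \<open>v\<close>; this branch
    contains no other member of \<open>A\<close>. If \<open>L\<close> is empty, no vertex next to \<open>v\<close> has been used yet, and
    the first step towards another member of \<open>A\<close> is outside \<open>B\<close>; if there is no other
    member, any vertex at distance at least three is unused.\<close>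
  have "\<exists>e. e \<in> pverts G - B \<and> e \<notin> A3 \<and> e \<notin> f ` N \<and> e \<notin> stem ` L"
  proof (cases "L = {}")
    case False
    then obtain l where l: "l \<in> L" by blast
    then have lA: "l \<in> A" "l \<in> leaves G" "hops v l = 2" "l \<noteq> v" by (auto simp: L_def)
    have lV: "l \<in> pverts G" using lA leaf_in_verts by blast
    have "stem l \<noteq> w" using P[OF l] w by auto
    have lw: "hops l w = 3" using away[OF lA(1,4)] lA by (auto simp: hops_commute)
    have "w \<notin> leaves G"
    proof
      assume wl: "w \<in> leaves G"
      then have "stem w = v" using stem_eq vw arc_sym by blast
      moreover have "stem l \<noteq> v" using P[OF l] arc_neq by blast
      ultimately show False using distant[OF lA(2) wl] lw by simp
    qed
    then obtain x where x: "(w, x) \<in> parcs G" "hops v x = 2"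
      using farther_neighbour[OF V] hops_arc[OF vw] by (metis Suc_1)
    have xV: "x \<in> pverts G" using x by (auto dest: in_arcsD2)
    have "x \<notin> leaves G"
    proof
      assume xl: "x \<in> leaves G"
      then have "stem x = w" using stem_eq x arc_sym by blast
      then show False using distant[OF lA(2) xl] \<open>stem l \<noteq> w\<close> hops_arc_le[OF lV x(1)] lw by simp
    qed
    then obtain z where z: "(x, z) \<in> parcs G" "hops v z = 3"
      using farther_neighbour[OF V(1) xV] x by (metis eval_nat_numeral(3))
    have wx: "hops w x = 1" using hops_arc[OF x(1)] .
    have "z \<notin> A"
    proof
      assume "z \<in> A"
      then have "hops w z = 4" using away[of z] z by (cases "z = v") auto
      then show False using hops_arc_le[OF V(2) z(1)] wx by simp
    qed
    moreover have "z \<notin> f ` N"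
    proof
      assume "z \<in> f ` N"
      then have "x \<in> N" using f_unique z x by blast
      then have "hops w x = 3" using away[of x] x by (cases "x = v") (auto simp: N_def)
      then show False using wx by simp
    qed
    moreover have "z \<notin> stem ` L" using P hops_arc z by fastforce
    moreover have "z \<in> pverts G" using z by (auto dest: in_arcsD2)
    ultimately show ?thesis using far_C z by (intro exI[of _ z]) (auto simp: A3_def)
  next
    case L: True
    show ?thesis
    proof (cases "A = {v}")
      case True
      obtain l l' where l: "l \<in> leaves G" "l' \<in> leaves G" "stem l \<noteq> stem l'"
        using two_supports by blast
      then have "5 \<le> hops v l + hops v l'"
        using distant[OF l] hops_triangle[of l v l'] V leaf_in_verts hops_commute[of l v] by fastforce
      then obtain z where "z \<in> pverts G" "hops v z \<ge> 3"
        using l leaf_in_verts by (cases "hops v l \<ge> 3") fastforce+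
      moreover have "A3 = {}" "N = {}" using True by (auto simp: A3_def N_def)
      ultimately show ?thesis using L far_C by auto
    next
      case False
      then obtain u where u: "u \<in> A" "u \<noteq> v" using v by blast
      obtain p where p: "(v, p) \<in> parcs G" "p \<notin> B" using away[OF u] by blast
      have "hops v p = 1" using hops_arc[OF p(1)] .
      then show ?thesis using p L f by (intro exI[of _ p]) (auto simp: A3_def dest: in_arcsD2)
    qed
  qed
  then obtain e where e: "e \<in> pverts G - B" "e \<notin> A3" "e \<notin> f ` N" "e \<notin> stem ` L" by blast
  have disj: "A3 \<inter> f ` N = {}" "(A3 \<union> f ` N) \<inter> stem ` L = {}"
    using f_A f P hops_arc by (fastforce simp: A3_def)+
  have "A3 \<subseteq> pverts G - B" using far_C A_sub by (auto simp: A3_def)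
  moreover have "f ` N \<subseteq> pverts G - B"
  proof (rule image_subsetI)
    fix u assume "u \<in> N"
    then show "f u \<in> pverts G - B" using f[of u] far_C[of "f u"] in_arcsD2[of u "f u"] by simp
  qed
  moreover have "stem ` L \<subseteq> pverts G - B"
  proof (rule image_subsetI)
    fix l assume "l \<in> L"
    then show "stem l \<in> pverts G - B" using P[of l] in_arcsD2[of v "stem l"] by simp
  qed
  ultimately have "insert e (A3 \<union> f ` N \<union> stem ` L) \<subseteq> pverts G - B"
    using e(1) by blast
  then have "card (insert e (A3 \<union> f ` N \<union> stem ` L)) \<le> card (pverts G - B)"
    using pair_finite_verts by (intro card_mono) auto
  moreover have "card (insert e (A3 \<union> f ` N \<union> stem ` L)) = Suc (card A3 + card N + card (stem ` L))"
    using e fin disj \<open>inj_on f N\<close> by (simp add: card_Un_disjoint card_image)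
  moreover have "card (pverts G - B) + card B = card (pverts G)"
    using card_mono[OF pair_finite_verts B_sub] by (simp add: card_Diff_subset B_sub)
  moreover have "card L + card (support_vertices G) \<le> card (leaves G) + card (stem ` L)"
    by (rule leaf_excess) (auto simp: L_def)
  moreover have "card A \<le> Suc (card A3 + card N + card L)"
  proof -
    have "card A \<le> card ({v} \<union> A3 \<union> N \<union> L)" using A_eq fin by (intro card_mono) auto
    also have "\<dots> \<le> card ({v} \<union> A3 \<union> N) + card L" by (rule card_Un_le)
    also have "card ({v} \<union> A3 \<union> N) \<le> card ({v} \<union> A3) + card N" by (rule card_Un_le)
    also have "card ({v} \<union> A3) \<le> card {v} + card A3" by (rule card_Un_le)
    finally show ?thesis by simp
  qed
  ultimately show ?thesis by linarith
qed

lemma card_bound: "card S + card (support_vertices G) \<le> card (pverts G) + card (leaves G)"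
proof (cases "Root \<in> S")
  case True
  moreover have "card (support_vertices G) \<le> card (leaves G)"
    by (simp add: support_vertices_stem card_image_le)
  ultimately show ?thesis using card_S card_bound_Root by fastforce
next
  case False
  then have "card S \<le> card A + card B" using card_S by simp
  moreover have "card A + card B + card (support_vertices G) \<le> card (pverts G) + card (leaves G)"
    using card_bound_isolated card_bound_adjacent by blast
  ultimately show ?thesis by simp
qed

end

lemma (in distant_leaf_tree) gp_mycielskian:
  "gp (mycielskian G) + card (support_vertices G) = card (pverts G) + card (leaves G)"
proof -
  let ?GP = "{S. general_position (mycielskian G) S}"
  have "finite ?GP"
    using M.pair_finite_verts by (rule_tac Finite_Set.finite_subset[of _ "Pow (pverts (mycielskian G))"])
      (auto simp: general_position_def)
  have "card S + card (support_vertices G) \<le> card (pverts G) + card (leaves G)"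
    if "general_position (mycielskian G) S" for S
  proof -
    interpret myc_general_position G S by unfold_locales (rule that)
    show ?thesis by (rule card_bound)
  qed
  then have "card S \<le> card extremal_set" if "S \<in> ?GP" for S
    using that card_extremal_set by fastforce
  then have "gp (mycielskian G) = card extremal_set"
    unfolding gp_def using \<open>finite ?GP\<close> general_position_extremal_set
    by (intro Max_eqI) auto
  then show ?thesis using card_extremal_set by simp
qed

theorem corollary33:
  fixes T :: "'a pair_pre_digraph" and n l s :: nat
  assumes "graph_tree T"
    and "card (pverts T) = n" and "n \<ge> 3"
    and "card (leaves T) = l"
    and "card (support_vertices T) = s" and "s \<ge> 2"
    and "leaf_dist T \<ge> 5"
  shows "int (gp (mycielskian T)) = int n + int l - int s"
proof -
  interpret tree_graph T
    using assms by (intro graph_tree_tree_graph) auto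
  have "\<exists>y\<in>support_vertices T. \<exists>y'\<in>support_vertices T. y \<noteq> y'"
    using assms(5,6) card_le_Suc0_iff_eq
    by (metis One_nat_def card.infinite not_less_eq_eq numeral_2_eq_2 zero_le)
  then interpret distant_leaf_tree T
    using leaf_dist_hops[OF assms(7)] by unfold_locales (auto simp: support_vertices_stem)
  show ?thesis using gp_mycielskian assms by simp
qed

end
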